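(* Let $(\Omega,\rho)$ be a compact metric space equipped with a Borel probability measure $P$, containing the set $\mathbb{N}$ of non-negative integers as a dense subset. Let $\mathcal{M}$ be a compact metric space with a Borel probability measure $\tilde{P}$. A mapping $x:\mathbb{N}\to\mathcal{M}$ is $\pi$-uniformly measurable if and only if $$\lim_{N\to\infty}\frac1N\sum_{n=1}^N f(x(k_n))=\int f\,d\tilde{P}$$ for every continuous real function $f$ defined on $\mathcal{M}$ and every sequence $\{k_n\}$ of elements of $\mathbb{N}$ that is uniformly distributed in $\Omega$.
   Context: For $S\subset\mathbb{N}$ put $\pi^\ast(S)=P(cl(S))$, where $cl$ is the closure in $\Omega$. Let $\mathcal{Y}$ be the system of all $A\subset\mathbb{N}$ with $\pi^\ast(A)+\pi^\ast(\mathbb{N}\setminus A)=1$, and let $\pi=\pi^\ast|_{\mathcal{Y}}$. A measurable set $A\subset\mathcal{M}$ is a set of $\tilde{P}$-continuity if $\tilde{P}(cl(A)\setminus Int(A))=0$, with closure and interior taken in $\mathcal{M}$. A mapping $y:\mathbb{N}\to\mathcal{M}$ is $\pi$-uniformly measurable if for every set of $\tilde{P}$-continuity $A\subset\mathcal{M}$ we have $y^{-1}(A)\in\mathcal{Y}$ and $\pi(y^{-1}(A))=\tilde{P}(A)$. A sequence $\{a_n\}$ of elements of $\Omega$ is uniformly distributed in $\Omega$ if $\lim_{N\to\infty}\frac1N\sum_{n=1}^N g(a_n)=\int g\,dP$ for every continuous real function $g$ on $\Omega$. *)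

theory Defs
  imports "HOL-Probability.Probability"
begin

text \<open>The compact metric space containing the non-negative integers as a dense subset is
  modelled by a metric type that is compact as a whole, together with an injection
  \<open>\<iota> :: nat \<Rightarrow> 'w\<close> of dense range; a set \<open>S :: nat set\<close> is identified with \<open>\<iota> ` S\<close>.\<close>

definition pi_star :: "'w::metric_space measure \<Rightarrow> (nat \<Rightarrow> 'w) \<Rightarrow> nat set \<Rightarrow> real" where
  "pi_star P \<iota> S = measure P (closure (\<iota> ` S))"

definition pi_system :: "'w::metric_space measure \<Rightarrow> (nat \<Rightarrow> 'w) \<Rightarrow> nat set set" where
  "pi_system P \<iota> = {A. pi_star P \<iota> A + pi_star P \<iota> (UNIV - A) = 1}"

definition pi_density :: "'w::metric_space measure \<Rightarrow> (nat \<Rightarrow> 'w) \<Rightarrow> nat set \<Rightarrow> real" where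
  "pi_density P \<iota> = restrict (pi_star P \<iota>) (pi_system P \<iota>)"

definition continuity_set :: "'m::metric_space measure \<Rightarrow> 'm set \<Rightarrow> bool" where
  "continuity_set Q A \<longleftrightarrow> A \<in> sets Q \<and> measure Q (closure A - interior A) = 0"

definition pi_uniformly_measurable ::
  "'w::metric_space measure \<Rightarrow> (nat \<Rightarrow> 'w) \<Rightarrow> 'm::metric_space measure \<Rightarrow> (nat \<Rightarrow> 'm) \<Rightarrow> bool" where
  "pi_uniformly_measurable P \<iota> Q y \<longleftrightarrow>
     (\<forall>A. continuity_set Q A \<longrightarrow>
        y -` A \<in> pi_system P \<iota> \<and> pi_density P \<iota> (y -` A) = measure Q A)"

text \<open>Sequences are indexed from 1; the value at 0 is irrelevant.\<close>

definition uniformly_distributed :: "'w::metric_space measure \<Rightarrow> (nat \<Rightarrow> 'w) \<Rightarrow> bool" where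
  "uniformly_distributed P a \<longleftrightarrow>
     (\<forall>g :: 'w \<Rightarrow> real. continuous_on UNIV g \<longrightarrow>
        (\<lambda>N. (\<Sum>n=1..N. g (a n)) / real N) \<longlonglongrightarrow> (LINT w|P. g w))"

end

theory Submission
  imports Defs
begin

text \<open>If \<open>k\<close> is uniformly distributed, the asymptotic frequency of \<open>k n \<in> S\<close> is at most
  \<open>pi_star S\<close>; for \<open>S\<close> in the system \<open>pi_system\<close> the same bound for the complement makes it converge to
  \<open>pi_star S\<close>. Slicing the range of \<open>f\<close> at levels that are null for the image measure gives
  \<open>Q\<close>-continuity sets, and the means of \<open>f\<close> follow.
  Conversely, for every \<open>S\<close> there is a uniformly distributed \<open>k\<close> that visits \<open>S\<close> with lower
  frequency at least \<open>pi_star S\<close>: take a uniformly distributed sequence in the whole space with the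
  right frequency in \<open>cl S\<close>, and approximate its points by integers, taken in \<open>S\<close> whenever the point
  lies in \<open>cl S\<close>. Hence \<open>pi_star (x -` A) \<le> Q (cl A)\<close>, and likewise for the complement of
  \<open>A\<close>; since \<open>pi_star\<close> is subadditive, equality holds for continuity sets.\<close>

section \<open>Cesaro means and approximation by simple functions\<close>

text \<open>Fixing one test function lets the same notion cover continuous functions (all of them
  together express uniform distribution) and indicators (asymptotic frequencies).\<close>

definition mean_converges :: "'a measure \<Rightarrow> (nat \<Rightarrow> 'a) \<Rightarrow> ('a \<Rightarrow> real) \<Rightarrow> bool" where
  "mean_converges M z f \<longleftrightarrow> (\<lambda>N. (\<Sum>n=1..N. f (z n)) / real N) \<longlonglongrightarrow> (LINT w|M. f w)"

lemma mean_abs_le: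
  fixes u :: "nat \<Rightarrow> real"
  assumes "\<And>n. \<bar>u n\<bar> \<le> e" "0 \<le> e"
  shows "\<bar>(\<Sum>n=1..N. u n) / real N\<bar> \<le> e"
proof -
  have "\<bar>\<Sum>n=1..N. u n\<bar> \<le> (\<Sum>n=1..N. e)"
    using assms by (intro order_trans[OF sum_abs] sum_mono) auto
  then show ?thesis
    using assms by (cases "N = 0") (auto simp: field_simps)
qed

text \<open>Cesaro's argument: the terms before \<open>n0\<close> contribute at most a constant
  \<open>C\<close>, which division by \<open>N\<close> makes negligible, and the remaining terms are
  uniformly small.\<close>

lemma mean_tendsto_zero:
  fixes u :: "nat \<Rightarrow> real"
  assumes "u \<longlonglongrightarrow> 0"
  shows "(\<lambda>N. (\<Sum>n=1..N. u n) / real N) \<longlonglongrightarrow> 0"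
proof (rule LIMSEQ_I)
  fix r :: real assume r: "r > 0"
  obtain n0 where n0: "\<And>n. n \<ge> n0 \<Longrightarrow> \<bar>u n\<bar> < r / 2"
    using LIMSEQ_D[OF assms, of "r/2"] r by auto
  define v where "v n = (if n < n0 then 0 else u n)" for n
  define C where "C = (\<Sum>n=1..n0. \<bar>u n\<bar>)"
  have split: "\<bar>(\<Sum>n=1..N. u n) - (\<Sum>n=1..N. v n)\<bar> \<le> C" for N
  proof -
    have "\<bar>(\<Sum>n=1..N. u n) - (\<Sum>n=1..N. v n)\<bar> \<le> (\<Sum>n=1..N. \<bar>u n - v n\<bar>)"
      unfolding sum_subtractf[symmetric] by (rule sum_abs)
    also have "\<dots> = (\<Sum>n\<in>{1..N} \<inter> {..<n0}. \<bar>u n\<bar>)"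
      by (rule sum.mono_neutral_cong_right) (auto simp: v_def)
    also have "\<dots> \<le> C" unfolding C_def by (rule sum_mono2) auto
    finally show ?thesis .
  qed
  have "(\<lambda>N. C / real N) \<longlonglongrightarrow> 0" by (rule lim_const_over_n)
  from LIMSEQ_D[OF this, of "r/2"] r obtain n1 where
    n1: "\<And>n. n \<ge> n1 \<Longrightarrow> \<bar>C / real n\<bar> < r / 2" by auto
  show "\<exists>no. \<forall>N\<ge>no. norm ((\<Sum>n=1..N. u n) / real N - 0) < r"
  proof (intro exI allI impI)
    fix N assume "N \<ge> n1"
    have "\<bar>(\<Sum>n=1..N. v n) / real N\<bar> \<le> r / 2"
      using n0 r by (intro mean_abs_le) (auto simp: v_def not_less less_imp_le)
    moreover have "\<bar>(\<Sum>n=1..N. u n) / real N - (\<Sum>n=1..N. v n) / real N\<bar> \<le> C / real N"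
      using split[of N] by (simp add: diff_divide_distrib[symmetric] divide_right_mono)
    ultimately show "norm ((\<Sum>n=1..N. u n) / real N - 0) < r"
      using n1[OF \<open>N \<ge> n1\<close>] unfolding real_norm_def diff_0_right by linarith
  qed
qed

text \<open>Sampling \<open>f\<close> once per fibre gives a simple function within \<open>e\<close>
  of \<open>f\<close>, whose means converge by linearity. The index type stays free because the
  fibres are atoms of ball covers in one application and slices of the range of \<open>f\<close> in
  another.\<close>

lemma mean_converges_finite_fibers:
  fixes f :: "'a \<Rightarrow> real"
  assumes "prob_space M" and space: "space M = UNIV" and f: "f \<in> borel_measurable M"
    and ex: "\<And>e. e > 0 \<Longrightarrow> \<exists>\<phi> :: 'a \<Rightarrow> 'i. finite (range \<phi>) \<and>
      (\<forall>i \<in> range \<phi>. \<phi> -` {i} \<in> sets M \<and> mean_converges M z (indicator (\<phi> -` {i}))) \<and>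
      (\<forall>a b. \<phi> a = \<phi> b \<longrightarrow> \<bar>f a - f b\<bar> \<le> e)"
  shows "mean_converges M z f"
  unfolding mean_converges_def
proof (rule LIMSEQ_I)
  interpret prob_space M by fact
  fix r :: real assume "r > 0"
  \<comment> \<open>Three errors have to fit below \<open>r\<close>: replacing \<open>f\<close> by
    \<open>g\<close> in the mean, replacing it in the integral, and the convergence of the means of
    \<open>g\<close>.\<close>
  define e where "e = r / 4"
  have e: "e > 0" "r = 4 * e" using \<open>r > 0\<close> by (auto simp: e_def)
  obtain \<phi> :: "'a \<Rightarrow> 'i" where fin: "finite (range \<phi>)"
    and meas: "\<And>i. i \<in> range \<phi> \<Longrightarrow> \<phi> -` {i} \<in> sets M"
    and mean: "\<And>i. i \<in> range \<phi> \<Longrightarrow> mean_converges M z (indicator (\<phi> -` {i}))"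
    and close: "\<And>a b. \<phi> a = \<phi> b \<Longrightarrow> \<bar>f a - f b\<bar> \<le> e"
    using ex[OF e(1)] by metis
  define c where "c i = f (SOME a. \<phi> a = i)" for i
  define g where "g a = (\<Sum>i\<in>range \<phi>. c i * indicator (\<phi> -` {i}) a)" for a
  have g_eq: "g a = c (\<phi> a)" for a
  proof -
    have "g a = (\<Sum>i\<in>range \<phi>. if i = \<phi> a then c i else 0)"
      unfolding g_def by (rule sum.cong) (auto simp: indicator_def)
    then show ?thesis using fin by simp
  qed
  have fg: "\<bar>f a - g a\<bar> \<le> e" for a
    unfolding g_eq c_def by (rule close) (metis (mono_tags, lifting) someI_ex)
  have ind_int: "integrable M (indicator (\<phi> -` {i}) :: 'a \<Rightarrow> real)" if "i \<in> range \<phi>" for i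
    using meas[OF that] by (simp add: emeasure_eq_measure)
  have g_int: "integrable M g"
    unfolding g_def using ind_int by (intro Bochner_Integration.integrable_sum) auto
  \<comment> \<open>Boundedness of \<open>f\<close> is not assumed: it is inherited from
    \<open>g\<close>, which takes finitely many values.\<close>
  have "finite (range g)"
    by (rule finite_subset[OF _ finite_imageI[OF fin, of c]]) (auto simp: g_eq)
  then obtain B where B: "\<And>a. \<bar>g a\<bar> \<le> B"
    by (metis bounded_real finite_imp_bounded rangeI)
  have f_int: "integrable M f"
  proof (rule integrable_const_bound[of _ "B + e"])
    show "AE a in M. norm (f a) \<le> B + e"
      using fg B by (intro AE_I2) (smt (verit) real_norm_def)
  qed (rule f)
  have "(\<lambda>N. \<Sum>i\<in>range \<phi>. c i * ((\<Sum>n=1..N. indicator (\<phi> -` {i}) (z n)) / real N))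
      \<longlonglongrightarrow> (\<Sum>i\<in>range \<phi>. c i * (LINT w|M. indicator (\<phi> -` {i}) w))"
    using mean unfolding mean_converges_def by (intro tendsto_sum tendsto_mult_left)
  also have "(\<lambda>N. \<Sum>i\<in>range \<phi>. c i * ((\<Sum>n=1..N. indicator (\<phi> -` {i}) (z n)) / real N))
      = (\<lambda>N. (\<Sum>n=1..N. g (z n)) / real N)"
  proof
    fix N
    have "(\<Sum>n=1..N. g (z n)) = (\<Sum>i\<in>range \<phi>. \<Sum>n=1..N. c i * indicator (\<phi> -` {i}) (z n))"
      unfolding g_def by (rule sum.swap)
    then show "(\<Sum>i\<in>range \<phi>. c i * ((\<Sum>n=1..N. indicator (\<phi> -` {i}) (z n)) / real N))
      = (\<Sum>n=1..N. g (z n)) / real N"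
      by (simp only: sum_divide_distrib sum_distrib_left times_divide_eq_right)
  qed
  also have "(\<Sum>i\<in>range \<phi>. c i * (LINT w|M. indicator (\<phi> -` {i}) w)) = (LINT w|M. g w)"
    unfolding g_def using ind_int by (subst Bochner_Integration.integral_sum) auto
  finally have g_lim: "(\<lambda>N. (\<Sum>n=1..N. g (z n)) / real N) \<longlonglongrightarrow> (LINT w|M. g w)" .
  have int_diff: "\<bar>(LINT w|M. f w) - (LINT w|M. g w)\<bar> \<le> e"
  proof -
    have "\<bar>LINT w|M. f w - g w\<bar> \<le> (LINT w|M. \<bar>f w - g w\<bar>)"
      by (rule integral_abs_bound)
    also have "\<dots> \<le> (LINT w|M. e)"
      using fg f_int g_int by (intro integral_mono) auto
    also have "\<dots> = e" by (simp add: prob_space)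
    finally show ?thesis using f_int g_int by simp
  qed
  obtain n0 where n0: "\<And>N. N \<ge> n0 \<Longrightarrow>
      \<bar>(\<Sum>n=1..N. g (z n)) / real N - (LINT w|M. g w)\<bar> < e"
    using LIMSEQ_D[OF g_lim e(1)] by auto
  show "\<exists>no. \<forall>N\<ge>no. norm ((\<Sum>n=1..N. f (z n)) / real N - (LINT w|M. f w)) < r"
  proof (intro exI allI impI)
    fix N assume "N \<ge> n0"
    have "\<bar>(\<Sum>n=1..N. f (z n) - g (z n)) / real N\<bar> \<le> e"
      using fg e by (intro mean_abs_le) auto
    then have "\<bar>(\<Sum>n=1..N. f (z n)) / real N - (\<Sum>n=1..N. g (z n)) / real N\<bar> \<le> e"
      by (simp add: sum_subtractf diff_divide_distrib)
    then show "norm ((\<Sum>n=1..N. f (z n)) / real N - (LINT w|M. f w)) < r"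
      using n0[OF \<open>N \<ge> n0\<close>] int_diff e unfolding real_norm_def by linarith
  qed
qed

section \<open>Frequencies of visits to closed sets\<close>

text \<open>One half of the portmanteau theorem: continuous functions above the indicator of
  \<open>F\<close> decrease to it, so by dominated convergence one of them has integral within
  \<open>e\<close> of the measure of \<open>F\<close>, and its means bound the frequencies.\<close>

lemma limsup_frequency_closed:
  fixes M :: "'a::metric_space measure"
  assumes "prob_space M" and sets: "sets M = sets borel"
    and mean: "\<And>f. continuous_on UNIV f \<Longrightarrow> mean_converges M z f"
    and "closed F" and "e > 0"
  shows "\<forall>\<^sub>F N in sequentially.
    (\<Sum>n=1..N. indicator F (z n)) / real N \<le> measure M F + e"
\<comment> \<open>The empty set is separated because \<open>infdist\<close> to it is 0 by
  convention, which would make every \<open>g m\<close> below constantly 1.\<close>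
proof (cases "F = {}")
  case True
  then show ?thesis using \<open>e > 0\<close> by simp
next
  case False
  interpret prob_space M by fact
  note [measurable_cong] = sets
  define g where "g m w = max 0 (1 - real m * infdist w F)" for m w
  have cont: "continuous_on UNIV (g m)" for m
    unfolding g_def by (intro continuous_intros)
  have [measurable]: "F \<in> sets M" using \<open>closed F\<close> sets by simp
  have [measurable]: "g m \<in> borel_measurable M" for m
    using borel_measurable_continuous_onI[OF cont[of m]]
    by (simp cong: measurable_cong_sets add: measurable_cong_sets[OF sets refl])
  have g_lim: "(\<lambda>m. g m w) \<longlonglongrightarrow> indicator F w" for w
  proof (cases "w \<in> F")
    case True
    then show ?thesis by (simp add: g_def)
  next
    case w: False
    then have pos: "infdist w F > 0"
      using \<open>closed F\<close> False by (metis in_closed_iff_infdist_zero infdist_nonneg le_less)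
    obtain m0 :: nat where m0: "1 < real m0 * infdist w F"
      using reals_Archimedean3[OF pos] by auto
    have "g m w = 0" if "m \<ge> m0" for m
    proof -
      have "real m0 * infdist w F \<le> real m * infdist w F"
        using that pos by (intro mult_right_mono) auto
      then show ?thesis using m0 by (simp add: g_def)
    qed
    then have "\<forall>\<^sub>F m in sequentially. g m w = indicator F w"
      using w by (auto simp: eventually_sequentially)
    then show ?thesis by (rule tendsto_eventually)
  qed
  have "(\<lambda>m. LINT w|M. g m w) \<longlonglongrightarrow> (LINT w|M. indicator F w)"
  proof (rule integral_dominated_convergence[where w = "\<lambda>_. 1"])
    show "AE w in M. norm (g m w) \<le> 1" for m
      by (rule AE_I2) (auto simp: g_def infdist_nonneg)
  qed (use g_lim in auto)
  then have "(\<lambda>m. LINT w|M. g m w) \<longlonglongrightarrow> measure M F" by simp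
  from LIMSEQ_D[OF this \<open>e > 0\<close>] obtain m where m: "\<bar>(LINT w|M. g m w) - measure M F\<bar> < e"
    by auto
  have "(\<lambda>N. (\<Sum>n=1..N. g m (z n)) / real N) \<longlonglongrightarrow> (LINT w|M. g m w)"
    using mean[OF cont] by (simp add: mean_converges_def)
  moreover have "(LINT w|M. g m w) < measure M F + e" using m by linarith
  ultimately have "\<forall>\<^sub>F N in sequentially. (\<Sum>n=1..N. g m (z n)) / real N < measure M F + e"
    by (rule order_tendstoD)
  then show ?thesis
  proof eventually_elim
    case (elim N)
    have "(\<Sum>n=1..N. indicator F (z n)) / real N \<le> (\<Sum>n=1..N. g m (z n)) / real N"
      by (intro divide_right_mono sum_mono) (auto simp: g_def indicator_def)
    then show ?case using elim by linarith
  qed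
qed

section \<open>Existence of sequences with prescribed frequencies\<close>

text \<open>The sequence is chosen greedily, as a derandomised law of large numbers: the potential
  \<open>\<Sum>i. 2\<^sup>-\<^sup>i (D i)\<^sup>2\<close> of the partial sums \<open>D i\<close> grows by at most \<open>2\<close> on average over the next
  point, so some next point does not exceed the average; then \<open>(D i)\<^sup>2\<close> is of order \<open>N\<close> after
  \<open>N\<close> steps.\<close>

lemma ex_sequence_means_tendsto_zero:
  fixes d :: "nat \<Rightarrow> 'a \<Rightarrow> real"
  assumes "prob_space M"
    and [measurable]: "\<And>i. d i \<in> borel_measurable M"
    and bound: "\<And>i w. \<bar>d i w\<bar> \<le> 1"
    and zero: "\<And>i. (LINT w|M. d i w) = 0"
  shows "\<exists>w. \<forall>i. (\<lambda>N. (\<Sum>n=1..N. d i (w n)) / real N) \<longlonglongrightarrow> 0"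
proof -
  interpret prob_space M by fact
  define c :: "nat \<Rightarrow> real" where "c i = (1/2) ^ i" for i
  have c_pos: "c i > 0" for i by (simp add: c_def)
  have c_sum: "c sums 2" unfolding c_def using geometric_sums[of "1/2::real"] by simp
  have c_mult: "summable (\<lambda>i. c i * a i)" if "\<And>i. \<bar>a i\<bar> \<le> B" for a B
  proof (rule summable_comparison_test')
    show "summable (\<lambda>i. c i * B)" using c_sum by (intro summable_mult2) (simp add: sums_iff)
    show "norm (c i * a i) \<le> c i * B" for i
      using that[of i] c_pos[of i] by (simp add: abs_mult)
  qed
  \<comment> \<open>This sum is the cross term in the growth of the potential. Its integral is 0
    because each \<open>d i\<close> has mean zero, so it cannot be positive everywhere. The bound on
    \<open>D\<close> justifies exchanging sum and integral.\<close>
  have ex: "\<exists>w. (\<Sum>i. c i * (D i * d i w)) \<le> 0" if D: "\<And>i. \<bar>D i\<bar> \<le> B" for D B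
  proof (rule ccontr)
    assume "\<not> ?thesis"
    then have pos: "(\<Sum>i. c i * (D i * d i w)) > 0" for w by (auto simp: not_le)
    have bnd: "\<bar>D i * d i w\<bar> \<le> B" for i w
      using mult_mono[OF D[of i] bound[of i w]] order_trans[OF abs_ge_zero D[of i]]
      by (simp add: abs_mult)
    have dint: "integrable M (d i)" for i
      by (rule integrable_const_bound[of _ 1]) (use bound in auto)
    have int: "integrable M (\<lambda>w. c i * (D i * d i w))" for i
      using dint by auto
    have sm: "summable (\<lambda>i. norm (c i * (D i * d i w)))" for w
      using c_mult[of "\<lambda>i. \<bar>D i * d i w\<bar>" B] bnd[of _ w] c_pos
      by (simp add: abs_mult abs_of_pos)
    have sn: "summable (\<lambda>i. LINT w|M. norm (c i * (D i * d i w)))"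
    proof (rule summable_comparison_test')
      show "summable (\<lambda>i. c i * B)" using c_sum by (intro summable_mult2) (simp add: sums_iff)
      show "norm (LINT w|M. norm (c i * (D i * d i w))) \<le> c i * B" for i
      proof -
        have "(LINT w|M. norm (c i * (D i * d i w))) \<le> (LINT w|M. c i * B)"
          using int[of i] bnd[of i] c_pos[of i]
          by (intro integral_mono integrable_norm) (auto simp: abs_mult simp del: integrable_mult_right_iff)
        then show ?thesis by (simp add: prob_space)
      qed
    qed
    have "integrable M (\<lambda>w. \<Sum>i. c i * (D i * d i w))"
      by (rule integrable_suminf) (use int sm sn in auto)
    moreover have "(LINT w|M. (\<Sum>i. c i * (D i * d i w))) = (\<Sum>i. LINT w|M. c i * (D i * d i w))"
      by (rule integral_suminf) (use int sm sn in auto)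
    then have "(LINT w|M. (\<Sum>i. c i * (D i * d i w))) = 0" by (simp add: zero)
    ultimately have "AE w in M. (\<Sum>i. c i * (D i * d i w)) = 0"
      using pos by (subst (asm) integral_nonneg_eq_0_iff_AE) (auto simp: less_imp_le)
    then have "AE w in M. False" using pos by (auto elim!: eventually_mono simp: less_le)
    then show False by simp
  qed
  define pick where "pick D = (SOME w. (\<Sum>i. c i * (D i * d i w)) \<le> 0)" for D
  have pick: "(\<Sum>i. c i * (D i * d i (pick D))) \<le> 0" if "\<And>i. \<bar>D i\<bar> \<le> B" for D B
    unfolding pick_def using someI_ex[OF ex[OF that]] .
  \<comment> \<open>The recursion carries the whole family of partial sums, since the choice of the
    next point depends on nothing else.\<close>
  define D where "D = rec_nat (\<lambda>i. 0) (\<lambda>_ D i. D i + d i (pick D))"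
  have D0: "D 0 i = 0" and DS: "D (Suc n) i = D n i + d i (pick (D n))" for n i
    by (simp_all add: D_def)
  \<comment> \<open>The point with index \<open>n\<close> is chosen from the state after
    \<open>n - 1\<close> points, which matches sums starting at 1.\<close>
  define w where "w n = pick (D (n - 1))" for n
  have D_sum: "(\<Sum>n=1..N. d i (w n)) = D N i" for i N
    by (induction N) (auto simp: D0 DS w_def)
  \<comment> \<open>This crude bound only secures summability; the useful bound is the one drawn
    from \<open>pot\<close>.\<close>
  have D_abs: "\<bar>D n i\<bar> \<le> real n" for n i
  proof (induction n)
    case (Suc n)
    then show ?case using bound[of i "pick (D n)"] by (simp add: DS)
  qed (simp add: D0)
  have D_sq: "\<bar>(D n i)\<^sup>2\<bar> \<le> (real n)\<^sup>2" for n i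
    using D_abs[of n i] by (simp add: abs_le_square_iff[symmetric])
  have pot: "(\<Sum>i. c i * (D n i)\<^sup>2) \<le> 2 * real n" for n
  proof (induction n)
    case (Suc n)
    let ?d = "\<lambda>i. d i (pick (D n))"
    have b1: "\<bar>D n i * ?d i\<bar> \<le> real n" for i
      using mult_mono[OF D_abs[of n i] bound[of i "pick (D n)"]] by (simp add: abs_mult)
    have b2: "\<bar>(?d i)\<^sup>2\<bar> \<le> 1" for i using bound[of i] by (simp add: abs_square_le_1)
    note s = c_mult[OF D_sq[of n]] c_mult[OF b1] c_mult[OF b2]
    have "(\<Sum>i. c i * (D (Suc n) i)\<^sup>2)
        = (\<Sum>i. c i * (D n i)\<^sup>2 + 2 * (c i * (D n i * ?d i)) + c i * (?d i)\<^sup>2)"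
      by (simp add: DS power2_eq_square algebra_simps)
    also have "\<dots> = (\<Sum>i. c i * (D n i)\<^sup>2) + 2 * (\<Sum>i. c i * (D n i * ?d i)) + (\<Sum>i. c i * (?d i)\<^sup>2)"
      using s by (simp add: suminf_add[symmetric] suminf_mult[symmetric] summable_add summable_mult)
    \<comment> \<open>The cross term is at most 0 by the choice of the point, and the squares are at
      most 1 against weights of total 2.\<close>
    also have "\<dots> \<le> 2 * real n + 2 * 0 + 2"
    proof (intro add_mono Suc.IH mult_left_mono pick)
      show "\<bar>D n i\<bar> \<le> real n" for i by (rule D_abs)
      have "(\<Sum>i. c i * (?d i)\<^sup>2) \<le> suminf c"
        using s(3) c_sum b2 c_pos
        by (intro suminf_le) (auto simp: sums_iff intro!: mult_left_le less_imp_le)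
      then show "(\<Sum>i. c i * (?d i)\<^sup>2) \<le> 2" using c_sum by (simp add: sums_iff)
    qed simp
    finally show ?case by simp
  qed (simp add: D0)
  \<comment> \<open>A single term of the potential is at most the whole. The factor
    \<open>1 / c i\<close> makes the rate depend on \<open>i\<close>, which is harmless since each
    \<open>i\<close> is treated separately.\<close>
  have bnd: "(D n i)\<^sup>2 \<le> 2 * real n / c i" for n i
  proof -
    have "c i * (D n i)\<^sup>2 \<le> (\<Sum>i. c i * (D n i)\<^sup>2)"
      using sum_le_suminf[OF c_mult[OF D_sq[of n]], of "{i}"] c_pos by (auto simp: less_imp_le)
    then show ?thesis using pot[of n] c_pos[of i] by (simp add: field_simps)
  qed
  have "(\<lambda>N. (\<Sum>n=1..N. d i (w n)) / real N) \<longlonglongrightarrow> 0" for i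
  proof (rule Lim_null_comparison)
    show "\<forall>\<^sub>F N in sequentially. norm ((\<Sum>n=1..N. d i (w n)) / real N) \<le> sqrt (2 / c i / real N)"
    proof (intro always_eventually allI)
      fix N
      have "((D N i) / real N)\<^sup>2 \<le> 2 * real N / c i / (real N)\<^sup>2"
        unfolding power_divide by (intro divide_right_mono bnd) simp
      also have "\<dots> = 2 / c i / real N" by (simp add: power2_eq_square)
      finally show "norm ((\<Sum>n=1..N. d i (w n)) / real N) \<le> sqrt (2 / c i / real N)"
        unfolding D_sum real_norm_def by (rule real_le_rsqrt[of "\<bar>_\<bar>", unfolded power2_abs])
    qed
    show "(\<lambda>N. sqrt (2 / c i / real N)) \<longlonglongrightarrow> 0"
      using tendsto_real_sqrt[OF lim_const_over_n[of "2 / c i"]] by simp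
  qed
  then show ?thesis by blast
qed

text \<open>Centring the indicators by their measures gives countably many functions of mean zero
  bounded by 1, to which the greedy choice applies.\<close>

lemma ex_sequence_frequencies:
  assumes "prob_space M" and "countable \<C>" and "\<C> \<subseteq> sets M"
  shows "\<exists>w. \<forall>C\<in>\<C>. mean_converges M w (indicator C)"
proof (cases "\<C> = {}")
  case False
  interpret prob_space M by fact
  define C where "C = from_nat_into \<C>"
  have C: "C i \<in> sets M" for i
    using assms(3) from_nat_into[OF False] by (auto simp: C_def)
  note [measurable] = C
  define d where "d i w = indicator (C i) w - measure M (C i)" for i w
  have "\<exists>w. \<forall>i. (\<lambda>N. (\<Sum>n=1..N. d i (w n)) / real N) \<longlonglongrightarrow> 0"
  proof (rule ex_sequence_means_tendsto_zero)
    show "d i \<in> borel_measurable M" for i unfolding d_def by measurable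
    show "\<bar>d i w\<bar> \<le> 1" for i w
      using prob_le_1[of "C i"] measure_nonneg[of M "C i"] by (auto simp: d_def indicator_def)
    show "(LINT w|M. d i w) = 0" for i
      unfolding d_def by (subst Bochner_Integration.integral_diff)
        (auto simp: emeasure_eq_measure prob_space)
  qed fact
  then obtain w where w: "\<And>i. (\<lambda>N. (\<Sum>n=1..N. d i (w n)) / real N) \<longlonglongrightarrow> 0" by blast
  have "mean_converges M w (indicator (C i))" for i
    unfolding mean_converges_def
  \<comment> \<open>The shift avoids \<open>N = 0\<close>, where both means are 0 by convention and
    adding the measure to the centred mean would not give the frequency.\<close>
  proof (rule LIMSEQ_offset[of _ 1])
    have "(\<lambda>N. (\<Sum>n=1..Suc N. d i (w n)) / real (Suc N) + measure M (C i)) \<longlonglongrightarrow> 0 + measure M (C i)"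
      by (intro tendsto_add LIMSEQ_Suc[OF w] tendsto_const)
    moreover have "(\<Sum>n=1..Suc N. d i (w n)) / real (Suc N) + measure M (C i)
        = (\<Sum>n=1..Suc N. indicator (C i) (w n)) / real (Suc N)" for N
    proof -
      have "(\<Sum>n=1..Suc N. d i (w n))
          = (\<Sum>n=1..Suc N. indicator (C i) (w n)) - real (Suc N) * measure M (C i)"
        unfolding d_def sum_subtractf by simp
      then show ?thesis by (simp add: field_simps del: sum.cl_ivl_Suc)
    qed
    ultimately show "(\<lambda>N. (\<Sum>n=1..N+1. indicator (C i) (w n)) / real (N+1)) \<longlonglongrightarrow> (LINT w|M. indicator (C i) w)"
      by simp
  qed
  then have "mean_converges M w (indicator X)" if "X \<in> \<C>" for X
    using from_nat_into_surj[OF assms(2) that] by (auto simp: C_def)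
  then show ?thesis by blast
qed simp

text \<open>Countably many frequencies suffice: those of the atoms of finite ball covers with radii
  tending to 0 control every continuous function through uniform continuity. The set
  \<open>F\<close> is adjoined to the family, which remains countable.\<close>

lemma ex_uniformly_distributed:
  fixes M :: "'a::metric_space measure"
  assumes comp: "compact (UNIV :: 'a set)"
    and "prob_space M" and sets: "sets M = sets borel" and F: "F \<in> sets M"
  shows "\<exists>w. uniformly_distributed M w \<and> mean_converges M w (indicator F)"
proof -
  define r where "r j = inverse (real (Suc j))" for j
  have "\<exists>K. finite K \<and> (UNIV :: 'a set) \<subseteq> (\<Union>c\<in>K. ball c (r j))" for j
    using compact_eq_totally_bounded[THEN iffD1, OF comp] by (simp add: r_def)
  then obtain K where K: "\<And>j. finite (K j)"
    "\<And>j. (UNIV :: 'a set) \<subseteq> (\<Union>c\<in>K j. ball c (r j))" by metis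
  \<comment> \<open>The fibres of \<open>\<phi> j\<close> are the atoms of the algebra generated by the \<open>j\<close>-th cover, so no
    ordering of the balls is needed to make them disjoint.\<close>
  define \<phi> where "\<phi> j w = {c \<in> K j. w \<in> ball c (r j)}" for j w
  have fin: "finite (range (\<phi> j))" for j
    by (rule finite_subset[of _ "Pow (K j)"]) (auto simp: \<phi>_def K(1))
  have meas: "\<phi> j -` {T} \<in> sets M" for j T
  proof (cases "T \<subseteq> K j")
    case True
    have "\<phi> j -` {T} = {w \<in> space M. \<forall>c\<in>K j. w \<in> ball c (r j) \<longleftrightarrow> c \<in> T}"
    proof (rule set_eqI)
      fix w
      show "w \<in> \<phi> j -` {T} \<longleftrightarrow> w \<in> {w \<in> space M. \<forall>c\<in>K j. w \<in> ball c (r j) \<longleftrightarrow> c \<in> T}"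
        using True sets_eq_imp_space_eq[OF sets]
        unfolding \<phi>_def vimage_def mem_Collect_eq singleton_iff set_eq_iff by auto
    qed
    also have "\<dots> \<in> sets M"
    proof (rule sets.sets_Collect_finite_All[OF _ K(1)])
      fix c
      have "ball c (r j) \<in> sets M" by (simp add: sets)
      then show "{w \<in> space M. (w \<in> ball c (r j)) = (c \<in> T)} \<in> sets M"
        by (cases "c \<in> T") (auto intro: sets.sets_Collect_neg simp del: mem_ball)
    qed
    finally show ?thesis .
  next
    case False
    then have "\<phi> j -` {T} = {}" by (auto simp: \<phi>_def)
    then show ?thesis by simp
  qed
  define \<C> where "\<C> = insert F (\<Union>j. (\<lambda>T. \<phi> j -` {T}) ` range (\<phi> j))"
  have "countable \<C>"
    unfolding \<C>_def
    by (intro countable_insert countable_UN[OF countableI_type] countable_image[OF countable_finite] fin)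
  moreover have "\<C> \<subseteq> sets M" unfolding \<C>_def using meas F by blast
  ultimately have "\<exists>w. \<forall>C\<in>\<C>. mean_converges M w (indicator C)"
    by (rule ex_sequence_frequencies[OF \<open>prob_space M\<close>])
  then obtain w where w: "\<forall>C\<in>\<C>. mean_converges M w (indicator C)"
    by (rule exE)
  have w_F: "mean_converges M w (indicator F)"
    by (rule bspec[OF w]) (simp add: \<C>_def)
  have w_fiber: "mean_converges M w (indicator (\<phi> j -` {T}))" if "T \<in> range (\<phi> j)" for j T
    by (rule bspec[OF w]) (unfold \<C>_def, use that in blast)
  have "mean_converges M w g" if g: "continuous_on UNIV g" for g
  proof (rule mean_converges_finite_fibers[OF \<open>prob_space M\<close>])
    show "space M = UNIV" using sets_eq_imp_space_eq[OF sets] by simp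
    show "g \<in> borel_measurable M"
      using borel_measurable_continuous_onI[OF g] by (simp add: measurable_cong_sets[OF sets refl])
    fix e :: real assume "e > 0"
    have "uniformly_continuous_on UNIV g" by (rule compact_uniformly_continuous[OF g comp])
    then obtain \<delta> where \<delta>: "\<delta> > 0"
      "\<And>a b. a \<in> UNIV \<Longrightarrow> b \<in> UNIV \<Longrightarrow> dist b a < \<delta> \<Longrightarrow> dist (g b) (g a) < e"
      using \<open>e > 0\<close> by (rule uniformly_continuous_onE) (rule that)
    \<comment> \<open>Points of one atom share a ball of radius \<open>r j\<close>, so they are less
      than \<open>\<delta>\<close> apart.\<close>
    obtain j where j: "r j < \<delta> / 2"
      using reals_Archimedean[of "\<delta> / 2"] \<delta>(1) by (auto simp: r_def simp del: of_nat_Suc)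
    have "\<bar>g a - g b\<bar> \<le> e" if "\<phi> j a = \<phi> j b" for a b
    proof -
      obtain c where c: "c \<in> K j" "a \<in> ball c (r j)"
        by (rule UN_E[OF subsetD[OF K(2) UNIV_I]]) (rule that)
      then have "b \<in> ball c (r j)" using that by (auto simp: \<phi>_def)
      then have "dist a b < \<delta>"
        using c j dist_triangle3[of a b c] by simp
      from \<delta>(2)[OF UNIV_I UNIV_I this[unfolded dist_commute[of a b]]] show ?thesis
        by (simp add: dist_real_def abs_minus_commute)
    qed
    then show "\<exists>\<phi> :: 'a \<Rightarrow> 'a set. finite (range \<phi>) \<and>
      (\<forall>i \<in> range \<phi>. \<phi> -` {i} \<in> sets M \<and> mean_converges M w (indicator (\<phi> -` {i}))) \<and>
      (\<forall>a b. \<phi> a = \<phi> b \<longrightarrow> \<bar>g a - g b\<bar> \<le> e)"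
      by (intro exI[of _ "\<phi> j"] conjI ballI fin meas w_fiber allI impI)
  qed
  then have "uniformly_distributed M w"
    by (simp add: uniformly_distributed_def mean_converges_def)
  with w_F show ?thesis by (intro exI conjI)
qed

section \<open>Passage from points of the space to integers\<close>

text \<open>Moving the points of a uniformly distributed sequence by distances tending to 0 does not
  affect the limits of means of continuous functions, while the direction of each move may be chosen
  to favour \<open>S\<close>.\<close>

lemma ex_uniformly_distributed_frequent:
  fixes P :: "'w::metric_space measure"
  assumes comp: "compact (UNIV :: 'w set)"
    and "prob_space P" and sets: "sets P = sets borel"
    and dense: "closure (range \<iota>) = UNIV"
  shows "\<exists>k :: nat \<Rightarrow> nat. uniformly_distributed P (\<lambda>n. \<iota> (k n)) \<and>
    (\<forall>e>0. \<forall>\<^sub>F N in sequentially.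
      pi_star P \<iota> S - e \<le> (\<Sum>n=1..N. indicator S (k n)) / real N)"
proof -
  interpret prob_space P by fact
  let ?F = "closure (\<iota> ` S)"
  have F: "?F \<in> sets P" by (simp add: sets)
  obtain w where ud: "uniformly_distributed P w" and freq: "mean_converges P w (indicator ?F)"
    using ex_uniformly_distributed[OF comp \<open>prob_space P\<close> sets F] by blast
  \<comment> \<open>For \<open>w n\<close> in \<open>?F\<close> the point comes from the image of
    \<open>S\<close>; otherwise density of the range of \<open>\<iota>\<close> provides some
    integer.\<close>
  have "\<exists>m. dist (\<iota> m) (w n) < inverse (real (Suc n)) \<and> (w n \<in> ?F \<longrightarrow> m \<in> S)" for n
  proof -
    have pos: "inverse (real (Suc n)) > 0" by simp
    have "w n \<in> closure (range \<iota>)" using dense by simp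
    then show ?thesis
      using pos unfolding closure_approachable by blast
  qed
  then obtain k where k: "\<And>n. dist (\<iota> (k n)) (w n) < inverse (real (Suc n))"
    and kS: "\<And>n. w n \<in> ?F \<Longrightarrow> k n \<in> S" by metis
  have "uniformly_distributed P (\<lambda>n. \<iota> (k n))"
    unfolding uniformly_distributed_def
  proof (intro allI impI)
    fix g :: "'w \<Rightarrow> real" assume g: "continuous_on UNIV g"
    have "(\<lambda>n. dist (\<iota> (k n)) (w n)) \<longlonglongrightarrow> 0"
      by (rule Lim_null_comparison[OF _ LIMSEQ_inverse_real_of_nat])
        (use k in \<open>auto intro!: always_eventually less_imp_le\<close>)
    then have "(\<lambda>n. dist (g (\<iota> (k n))) (g (w n))) \<longlonglongrightarrow> 0"
      using compact_uniformly_continuous[OF g comp, unfolded uniformly_continuous_on_sequentially,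
          rule_format, of "\<lambda>n. \<iota> (k n)" w] by simp
    then have "(\<lambda>n. g (\<iota> (k n)) - g (w n)) \<longlonglongrightarrow> 0"
      unfolding dist_real_def by (rule tendsto_rabs_zero_cancel)
    from mean_tendsto_zero[OF this]
    have "(\<lambda>N. (\<Sum>n=1..N. g (\<iota> (k n)) - g (w n)) / real N + (\<Sum>n=1..N. g (w n)) / real N)
        \<longlonglongrightarrow> 0 + (LINT w|P. g w)"
      using ud g unfolding uniformly_distributed_def by (intro tendsto_add) auto
    then show "(\<lambda>N. (\<Sum>n=1..N. g (\<iota> (k n))) / real N) \<longlonglongrightarrow> (LINT w|P. g w)"
      by (simp add: sum_subtractf diff_divide_distrib)
  qed
  \<comment> \<open>Only a lower bound results, because \<open>k n\<close> may fall in
    \<open>S\<close> even when \<open>w n\<close> lies outside \<open>?F\<close>.\<close>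
  moreover have "\<forall>\<^sub>F N in sequentially. pi_star P \<iota> S - e \<le> (\<Sum>n=1..N. indicator S (k n)) / real N"
    if "e > 0" for e
  proof -
    have "(\<lambda>N. (\<Sum>n=1..N. indicator ?F (w n)) / real N) \<longlonglongrightarrow> pi_star P \<iota> S"
      using freq F sets_eq_imp_space_eq[OF sets] by (simp add: mean_converges_def pi_star_def)
    moreover have "pi_star P \<iota> S - e < pi_star P \<iota> S" using that by simp
    ultimately have "\<forall>\<^sub>F N in sequentially. pi_star P \<iota> S - e < (\<Sum>n=1..N. indicator ?F (w n)) / real N"
      by (rule order_tendstoD)
    then show ?thesis
    proof eventually_elim
      case (elim N)
      have "(\<Sum>n=1..N. indicator ?F (w n)) / real N \<le> (\<Sum>n=1..N. indicator S (k n) :: real) / real N"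
        by (intro divide_right_mono sum_mono) (auto simp: indicator_def kS)
      then show ?case using elim by linarith
    qed
  qed
  ultimately show ?thesis by blast
qed

lemma pi_star_le_of_uniformly_distributed:
  fixes P :: "'w::metric_space measure" and Q :: "'m::metric_space measure"
  assumes comp: "compact (UNIV :: 'w set)"
    and "prob_space P" and "sets P = sets borel"
    and "closure (range \<iota>) = UNIV"
    and "prob_space Q" and "sets Q = sets borel"
    and mean: "\<And>f k. continuous_on UNIV f \<Longrightarrow> uniformly_distributed P (\<lambda>n. \<iota> (k n)) \<Longrightarrow>
        mean_converges Q (\<lambda>n. x (k n)) f"
  shows "pi_star P \<iota> (x -` A) \<le> measure Q (closure A)"
proof (rule field_le_epsilon)
  fix e :: real assume "e > 0"
  obtain k where ud: "uniformly_distributed P (\<lambda>n. \<iota> (k n))"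
    and k: "\<forall>\<^sub>F N in sequentially.
      pi_star P \<iota> (x -` A) - e / 2 \<le> (\<Sum>n=1..N. indicator (x -` A) (k n)) / real N"
    using ex_uniformly_distributed_frequent[OF assms(1-4), of "x -` A"] \<open>e > 0\<close> half_gt_zero by blast
  have "\<forall>\<^sub>F N in sequentially.
      (\<Sum>n=1..N. indicator (closure A) (x (k n))) / real N \<le> measure Q (closure A) + e / 2"
    by (rule limsup_frequency_closed[OF assms(5,6)]) (use mean ud \<open>e > 0\<close> in auto)
  with k have "\<forall>\<^sub>F N in sequentially. pi_star P \<iota> (x -` A) \<le> measure Q (closure A) + e"
  proof eventually_elim
    case (elim N)
    have "(\<Sum>n=1..N. indicator (x -` A) (k n) :: real) / real N
        \<le> (\<Sum>n=1..N. indicator (closure A) (x (k n))) / real N"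
      using closure_subset[of A] by (intro divide_right_mono sum_mono) (auto simp: indicator_def)
    then show ?case using elim by linarith
  qed
  then show "pi_star P \<iota> (x -` A) \<le> measure Q (closure A) + e"
    by simp
qed

section \<open>Continuity sets and slices of continuous functions\<close>

lemma continuity_set_closure:
  fixes Q :: "'m::metric_space measure"
  assumes "prob_space Q" "sets Q = sets borel" "continuity_set Q A"
  shows "measure Q (closure A) = measure Q A" "measure Q (closure (- A)) = 1 - measure Q A"
proof -
  interpret prob_space Q by fact
  note [simp] = assms(2)
  have A: "A \<in> sets Q" and zero: "measure Q (closure A - interior A) = 0"
    using assms(3) by (auto simp: continuity_set_def)
  have "measure Q (closure A) = measure Q (interior A)"
    using zero finite_measure_Diff[of "closure A" "interior A"] interior_subset[of A] closure_subset[of A]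
    by auto
  moreover have "measure Q (interior A) \<le> measure Q A" "measure Q A \<le> measure Q (closure A)"
    using A interior_subset[of A] closure_subset[of A] by (auto intro!: finite_measure_mono)
  ultimately show "measure Q (closure A) = measure Q A" by linarith
  have "measure Q (closure (- A)) = 1 - measure Q (interior A)"
    using prob_compl[of "interior A"] sets_eq_imp_space_eq[OF assms(2)]
    by (simp add: closure_complement Compl_eq_Diff_UNIV[of "interior A"])
  then show "measure Q (closure (- A)) = 1 - measure Q A"
    using \<open>measure Q (closure A) = measure Q (interior A)\<close> \<open>measure Q (closure A) = measure Q A\<close>
    by simp
qed

text \<open>The image measure has only countably many atoms, so the shifts that put some point of
  the grid on an atom form a countable set and cannot exhaust the reals.\<close>

lemma ex_null_level_shift:
  fixes f :: "'a \<Rightarrow> real"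
  assumes "prob_space M" and [measurable]: "f \<in> borel_measurable M"
  shows "\<exists>s. \<forall>i::int. measure M (f -` {s + of_int i * e} \<inter> space M) = 0"
proof -
  interpret prob_space M by fact
  interpret D: prob_space "distr M borel f" by (rule prob_space_distr) measurable
  define B where "B = {t. measure (distr M borel f) {t} \<noteq> 0}"
  have "countable (\<Union>i::int. (\<lambda>b. b - of_int i * e) ` B)"
    using D.countable_support unfolding B_def by (intro countable_UN countable_image) auto
  then have "(\<Union>i::int. (\<lambda>b. b - of_int i * e) ` B) \<noteq> UNIV"
    using uncountable_UNIV_real by metis
  then obtain s where s: "s \<notin> (\<Union>i::int. (\<lambda>b. b - of_int i * e) ` B)" by blast
  have "s + of_int i * e \<notin> B" for i :: int
  proof
    assume "s + of_int i * e \<in> B"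
    then have "s \<in> (\<lambda>b. b - of_int i * e) ` B"
      by (intro image_eqI[of _ _ "s + of_int i * e"]) auto
    then show False using s by blast
  qed
  then show ?thesis by (intro exI[of _ s]) (simp add: B_def measure_distr)
qed

text \<open>The range of \<open>f\<close> is cut into half-open intervals of length \<open>e\<close>
  with null endpoints. Compactness leaves finitely many slices, and the boundary of each lies in two
  null level sets.\<close>

lemma mean_converges_of_continuity_sets:
  fixes Q :: "'m::metric_space measure"
  assumes comp: "compact (UNIV :: 'm set)"
    and "prob_space Q" and sets: "sets Q = sets borel"
    and freq: "\<And>A. continuity_set Q A \<Longrightarrow> mean_converges Q z (indicator A)"
    and f: "continuous_on UNIV f"
  shows "mean_converges Q z f"
proof (rule mean_converges_finite_fibers[OF \<open>prob_space Q\<close>])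
  interpret prob_space Q by fact
  show space: "space Q = UNIV" using sets_eq_imp_space_eq[OF sets] by simp
  show f_meas: "f \<in> borel_measurable Q"
    using borel_measurable_continuous_onI[OF f] by (simp add: measurable_cong_sets[OF sets refl])
  fix e :: real assume e: "e > 0"
  obtain s where s: "\<And>i::int. measure Q (f -` {s + of_int i * e}) = 0"
    using ex_null_level_shift[OF \<open>prob_space Q\<close> f_meas, of e] space by auto
  define \<phi> where "\<phi> a = \<lfloor>(f a - s) / e\<rfloor>" for a
  have \<phi>_iff: "\<phi> a = i \<longleftrightarrow> s + of_int i * e \<le> f a \<and> f a < s + of_int (i + 1) * e" for a i
    using e by (simp only: \<phi>_def floor_eq_iff pos_le_divide_eq pos_divide_less_eq of_int_add of_int_1) linarith
  have "bounded (range f)"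
    using compact_continuous_image[OF f comp] by (rule compact_imp_bounded)
  then obtain B where B: "\<And>a. \<bar>f a\<bar> \<le> B" by (auto simp: bounded_real)
  have "\<phi> a \<in> {\<lfloor>(- B - s) / e\<rfloor>..\<lfloor>(B - s) / e\<rfloor>}" for a
  proof -
    have "- B \<le> f a" "f a \<le> B" using B[of a] by linarith+
    then show ?thesis
      using e unfolding \<phi>_def by (auto intro!: floor_mono divide_right_mono)
  qed
  then have fin: "finite (range \<phi>)"
    by (intro finite_subset[OF image_subsetI finite_atLeastAtMost_int])
  have cs: "continuity_set Q (\<phi> -` {i})" for i
  proof -
    let ?a = "s + of_int i * e" and ?b = "s + of_int (i + 1) * e"
    have eq: "\<phi> -` {i} = f -` {?a..} \<inter> f -` {..<?b}" by (rule set_eqI) (simp add: \<phi>_iff)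
    have cl: "closed (f -` {c..})" "closed (f -` {..c})" "closed (f -` {c})" for c
      using f by (auto intro!: closed_vimage)
    have op: "open (f -` {c<..})" "open (f -` {..<c})" for c
      using f by (auto intro!: open_vimage)
    \<comment> \<open>The closure can add only points of the level \<open>?b\<close>, and the
      interior can lose only points of the level \<open>?a\<close>.\<close>
    have 1: "closure (\<phi> -` {i}) \<subseteq> f -` {?a..} \<inter> f -` {..?b}"
      by (rule closure_minimal) (auto simp: eq intro!: closed_Int cl)
    have 2: "f -` {?a<..} \<inter> f -` {..<?b} \<subseteq> interior (\<phi> -` {i})"
      by (rule interior_maximal) (auto simp: eq intro!: open_Int op)
    have "measure Q (closure (\<phi> -` {i}) - interior (\<phi> -` {i})) \<le> measure Q (f -` {?a} \<union> f -` {?b})"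
      using 1 2 cl(3) by (intro finite_measure_mono) (auto simp: sets, force+)
    also have "\<dots> \<le> measure Q (f -` {?a}) + measure Q (f -` {?b})"
      by (rule measure_Un_le) (auto simp: sets cl)
    also have "\<dots> = 0" using s[of i] s[of "i + 1"] by simp
    finally have "measure Q (closure (\<phi> -` {i}) - interior (\<phi> -` {i})) = 0"
      by (simp add: measure_le_0_iff)
    moreover have "\<phi> -` {i} \<in> sets Q"
      unfolding eq using cl op by (intro sets.Int) (auto simp: sets)
    ultimately show ?thesis by (simp add: continuity_set_def)
  qed
  have close: "\<bar>f a - f b\<bar> \<le> e" if "\<phi> a = \<phi> b" for a b
    using \<phi>_iff[of a "\<phi> b"] \<phi>_iff[of b "\<phi> b"] that by (auto simp: algebra_simps)
  show "\<exists>\<phi> :: 'm \<Rightarrow> int. finite (range \<phi>) \<and>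
      (\<forall>i \<in> range \<phi>. \<phi> -` {i} \<in> sets Q \<and> mean_converges Q z (indicator (\<phi> -` {i}))) \<and>
      (\<forall>a b. \<phi> a = \<phi> b \<longrightarrow> \<bar>f a - f b\<bar> \<le> e)"
    using fin cs freq[OF cs] close by (intro exI[of _ \<phi>]) (auto simp: continuity_set_def)
qed

section \<open>Frequencies for sets of the system, and the equivalence\<close>

text \<open>The closed-set bound holds for \<open>S\<close> and for its complement. Both the
  frequencies and the values of \<open>pi_star\<close> add up to 1, so the bound for the complement
  is a lower bound for \<open>S\<close>.\<close>

lemma frequency_pi_system:
  fixes P :: "'w::metric_space measure"
  assumes "prob_space P" and "sets P = sets borel"
    and ud: "uniformly_distributed P (\<lambda>n. \<iota> (k n))" and S: "S \<in> pi_system P \<iota>"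
  shows "(\<lambda>N. (\<Sum>n=1..N. indicator S (k n)) / real N) \<longlonglongrightarrow> pi_star P \<iota> S"
proof (rule LIMSEQ_I)
  fix r :: real assume "r > 0"
  have upper: "\<forall>\<^sub>F N in sequentially.
      (\<Sum>n=1..N. indicator T (k n)) / real N \<le> pi_star P \<iota> T + r / 2" for T
  proof -
    have "\<forall>\<^sub>F N in sequentially.
      (\<Sum>n=1..N. indicator (closure (\<iota> ` T)) (\<iota> (k n))) / real N \<le> pi_star P \<iota> T + r / 2"
      unfolding pi_star_def
      by (rule limsup_frequency_closed[OF assms(1,2)])
        (use ud \<open>r > 0\<close> in \<open>auto simp: uniformly_distributed_def mean_converges_def\<close>)
    then show ?thesis
    proof eventually_elim
      case (elim N)
      have "(\<Sum>n=1..N. indicator T (k n) :: real) / real N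
          \<le> (\<Sum>n=1..N. indicator (closure (\<iota> ` T)) (\<iota> (k n))) / real N"
        using closure_subset[of "\<iota> ` T"]
        by (intro divide_right_mono sum_mono) (auto simp: indicator_def)
      then show ?case using elim by linarith
    qed
  qed
  have "\<forall>\<^sub>F N in sequentially.
      \<bar>(\<Sum>n=1..N. indicator S (k n)) / real N - pi_star P \<iota> S\<bar> < r"
    \<comment> \<open>Positivity of \<open>N\<close> is required because at \<open>N = 0\<close> the
      two frequencies would add up to 0.\<close>
    using upper[of S] upper[of "UNIV - S"] eventually_gt_at_top[of 0]
  proof eventually_elim
    case (elim N)
    have "(\<Sum>n=1..N. indicator S (k n) :: real) + (\<Sum>n=1..N. indicator (UNIV - S) (k n)) = (\<Sum>n=1..N. 1)"
      unfolding sum.distrib[symmetric] by (rule sum.cong) (auto simp: indicator_def)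
    then have "(\<Sum>n=1..N. indicator S (k n) :: real) / real N
        + (\<Sum>n=1..N. indicator (UNIV - S) (k n)) / real N = 1"
      using elim(3) by (simp add: add_divide_distrib[symmetric])
    then show ?case
      using elim S \<open>r > 0\<close> unfolding pi_system_def mem_Collect_eq by linarith
  qed
  then show "\<exists>no. \<forall>N\<ge>no. norm ((\<Sum>n=1..N. indicator S (k n)) / real N - pi_star P \<iota> S) < r"
    by (simp add: eventually_sequentially)
qed

theorem proposition4:
  fixes P :: "'w::metric_space measure"
    and \<iota> :: "nat \<Rightarrow> 'w"
    and Q :: "'m::metric_space measure"
    and x :: "nat \<Rightarrow> 'm"
  assumes "compact (UNIV :: 'w set)"
    and "prob_space P" and "sets P = sets borel"
    and "inj \<iota>" and "closure (range \<iota>) = UNIV"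
    and "compact (UNIV :: 'm set)"
    and "prob_space Q" and "sets Q = sets borel"
  shows "pi_uniformly_measurable P \<iota> Q x \<longleftrightarrow>
    (\<forall>(f :: 'm \<Rightarrow> real) (k :: nat \<Rightarrow> nat).
        continuous_on UNIV f \<longrightarrow> uniformly_distributed P (\<lambda>n. \<iota> (k n)) \<longrightarrow>
        (\<lambda>N. (\<Sum>n=1..N. f (x (k n))) / real N) \<longlonglongrightarrow> (LINT z|Q. f z))"
proof
  assume pum: "pi_uniformly_measurable P \<iota> Q x"
  show "\<forall>(f :: 'm \<Rightarrow> real) (k :: nat \<Rightarrow> nat).
        continuous_on UNIV f \<longrightarrow> uniformly_distributed P (\<lambda>n. \<iota> (k n)) \<longrightarrow>
        (\<lambda>N. (\<Sum>n=1..N. f (x (k n))) / real N) \<longlonglongrightarrow> (LINT z|Q. f z)"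
  proof (intro allI impI)
    fix f :: "'m \<Rightarrow> real" and k
    assume f: "continuous_on UNIV f" and ud: "uniformly_distributed P (\<lambda>n. \<iota> (k n))"
    have "mean_converges Q (\<lambda>n. x (k n)) f"
    proof (rule mean_converges_of_continuity_sets[OF assms(6-8) _ f])
      fix A assume A: "continuity_set Q A"
      have S: "x -` A \<in> pi_system P \<iota>" "pi_star P \<iota> (x -` A) = measure Q A"
        using pum A by (auto simp: pi_uniformly_measurable_def pi_density_def)
      \<comment> \<open>Visits of \<open>x (k n)\<close> to \<open>A\<close> are visits of
        \<open>k n\<close> to the preimage, whose frequency is known.\<close>
      have "indicator (x -` A) m = (indicator A (x m) :: real)" for m
        by (simp add: indicator_def)
      then show "mean_converges Q (\<lambda>n. x (k n)) (indicator A)"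
        using frequency_pi_system[OF assms(2,3) ud S(1)] A S(2) sets_eq_imp_space_eq[OF assms(8)]
        by (simp add: mean_converges_def continuity_set_def)
    qed
    then show "(\<lambda>N. (\<Sum>n=1..N. f (x (k n))) / real N) \<longlonglongrightarrow> (LINT z|Q. f z)"
      by (simp add: mean_converges_def)
  qed
next
  assume means: "\<forall>(f :: 'm \<Rightarrow> real) (k :: nat \<Rightarrow> nat).
        continuous_on UNIV f \<longrightarrow> uniformly_distributed P (\<lambda>n. \<iota> (k n)) \<longrightarrow>
        (\<lambda>N. (\<Sum>n=1..N. f (x (k n))) / real N) \<longlonglongrightarrow> (LINT z|Q. f z)"
  interpret P: prob_space P by fact
  have le: "pi_star P \<iota> (x -` A) \<le> measure Q (closure A)" for A
    using means by (intro pi_star_le_of_uniformly_distributed[OF assms(1-3,5,7,8)])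
      (auto simp: mean_converges_def)
  show "pi_uniformly_measurable P \<iota> Q x"
    unfolding pi_uniformly_measurable_def
  proof (intro allI impI)
    fix A assume A: "continuity_set Q A"
    \<comment> \<open>By density the two closures cover the space, so the values of
      \<open>pi_star\<close> add up to at least 1. The upper bounds that follow add up to exactly 1,
      which forces equality in both.\<close>
    have "closure (\<iota> ` (x -` A)) \<union> closure (\<iota> ` (UNIV - x -` A)) = space P"
      using assms(5) sets_eq_imp_space_eq[OF assms(3)]
      by (simp add: closure_Un[symmetric] image_Un[symmetric])
    then have "1 \<le> pi_star P \<iota> (x -` A) + pi_star P \<iota> (UNIV - x -` A)"
      using measure_Un_le[of "closure (\<iota> ` (x -` A))" P "closure (\<iota> ` (UNIV - x -` A))"]
      by (simp add: pi_star_def assms(3) P.prob_space)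
    moreover have "pi_star P \<iota> (x -` A) \<le> measure Q A"
      using le[of A] continuity_set_closure(1)[OF assms(7,8) A] by simp
    moreover have "pi_star P \<iota> (UNIV - x -` A) \<le> 1 - measure Q A"
      using le[of "- A"] continuity_set_closure(2)[OF assms(7,8) A]
      unfolding vimage_Compl Compl_eq_Diff_UNIV[of "x -` A"] by simp
    ultimately show "x -` A \<in> pi_system P \<iota> \<and> pi_density P \<iota> (x -` A) = measure Q A"
      by (auto simp: pi_system_def pi_density_def)
  qed
qed

end
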